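(* For all even positive integers $n$, $$t(n) \leq 0.1402\, n^2 .$$
   Context: For a positive integer $n$ let $[n]=\{1,\dots,n\}$. The $n\times n$ torus $\mathbb{T}_n$ is the hypergraph with vertex set $[n]\times[n]$ whose hyperedges are: the rows $\{i\}\times[n]$ for $i\in[n]$; the columns $[n]\times\{j\}$ for $j\in[n]$; the $\mathbb{Z}_n$-diagonals $\{(i,j)\in[n]\times[n] : i-j\equiv k \pmod n\}$ for $k\in\mathbb{Z}_n$; and the $\mathbb{Z}_n$-skew-diagonals $\{(i,j)\in[n]\times[n] : i+j\equiv k \pmod n\}$ for $k\in\mathbb{Z}_n$. A peaceful battle on $\mathbb{T}_n$ is a pair $(B,W)$ of disjoint subsets of $[n]\times[n]$ such that $e\cap B=\emptyset$ or $e\cap W=\emptyset$ for every hyperedge $e$ of $\mathbb{T}_n$. The number $t(n)$ is the maximum integer $m$ such that there is a peaceful battle $(B,W)$ on $\mathbb{T}_n$ with $|B|=|W|=m$. *)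

theory Defs
  imports Complex_Main "HOL-Number_Theory.Cong"
begin

definition torus_vertices :: "nat \<Rightarrow> (nat \<times> nat) set" where
  "torus_vertices n = {1..n} \<times> {1..n}"

definition torus_row :: "nat \<Rightarrow> nat \<Rightarrow> (nat \<times> nat) set" where
  "torus_row n i = {i} \<times> {1..n}"

definition torus_column :: "nat \<Rightarrow> nat \<Rightarrow> (nat \<times> nat) set" where
  "torus_column n j = {1..n} \<times> {j}"

text \<open>The congruences are over the integers, so that \<open>i - j\<close> is not truncated.\<close>

definition torus_diagonal :: "nat \<Rightarrow> int \<Rightarrow> (nat \<times> nat) set" where
  "torus_diagonal n k = {(i, j) \<in> torus_vertices n. [int i - int j = k] (mod int n)}"

definition torus_skew_diagonal :: "nat \<Rightarrow> int \<Rightarrow> (nat \<times> nat) set" where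
  "torus_skew_diagonal n k = {(i, j) \<in> torus_vertices n. [int i + int j = k] (mod int n)}"

text \<open>The elements of \<open>\<int>\<^sub>n\<close> are represented by the residues in \<open>{0..<int n}\<close>.\<close>

definition torus_edges :: "nat \<Rightarrow> (nat \<times> nat) set set" where
  "torus_edges n =
     torus_row n ` {1..n} \<union> torus_column n ` {1..n} \<union>
     torus_diagonal n ` {0..<int n} \<union> torus_skew_diagonal n ` {0..<int n}"

definition peaceful_battle :: "nat \<Rightarrow> (nat \<times> nat) set \<Rightarrow> (nat \<times> nat) set \<Rightarrow> bool" where
  "peaceful_battle n B W \<longleftrightarrow>
     B \<subseteq> torus_vertices n \<and> W \<subseteq> torus_vertices n \<and> B \<inter> W = {} \<and>
     (\<forall>e \<in> torus_edges n. e \<inter> B = {} \<or> e \<inter> W = {})"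

definition battle_sizes :: "nat \<Rightarrow> nat set" where
  "battle_sizes n = {m. \<exists>B W. peaceful_battle n B W \<and> card B = m \<and> card W = m}"

definition peaceful_number :: "nat \<Rightarrow> nat" where
  "peaceful_number n = Max (battle_sizes n)"

text \<open>\<open>Max\<close> is only meaningful on finite nonempty sets; this is the case here.\<close>

lemma zero_in_battle_sizes: "0 \<in> battle_sizes n"
  by (auto simp: battle_sizes_def peaceful_battle_def intro!: exI[of _ "{}"])

lemma finite_battle_sizes: "finite (battle_sizes n)"
proof (rule finite_subset)
  have fin: "finite (torus_vertices n)"
    by (simp add: torus_vertices_def)
  show "battle_sizes n \<subseteq> {..card (torus_vertices n)}"
    by (auto simp: battle_sizes_def peaceful_battle_def intro: card_mono[OF fin])
qed simp

end

theory Submission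
  imports Defs
begin

text \<open>
  Call a line (a hyperedge) black if it meets \<open>B\<close>, and white otherwise, and give it the sign
  \<open>1\<close> or \<open>-1\<close> accordingly. In a peaceful battle every cell of \<open>B\<close> lies on four black lines and
  every cell of \<open>W\<close> on four white ones. So one may bound \<open>|B|\<close> and \<open>|W|\<close> by averaging, over all
  \<open>n\<^sup>2\<close> cells, suitable quadratic polynomials in the four signs \<open>x, y, z, w\<close> (row, column,
  diagonal, skew diagonal) of a cell.

  Let \<open>a, b, c, d\<close> be the average signs of the rows, columns, diagonals and skew diagonals. A line
  meets every line of another class in exactly one cell, so that for instance \<open>x * z\<close> has
  average \<open>a * c\<close>. The only exception is \<open>z * w\<close>: for even \<open>n\<close> a diagonal and a skew diagonal
  meet in two cells or in none, depending on their parities, and the average of \<open>z * w\<close> is only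
  known to be at most \<open>1 - c - d + 2 * c * d\<close>. If \<open>|B| = |W| = t * n\<^sup>2\<close>, then three families of
  polynomials give:

  \<^item> \<open>4 * t \<le> (1 - a) * (1 - b)\<close> from \<open>(1 - x) * (1 - y)\<close>, and likewise for the other pairs of
    classes except the two kinds of diagonals;
  \<^item> \<open>8 * t \<le> 1 + a * b + a * c + b * c\<close> from \<open>1 + x * y + x * z + y * z\<close>, which is \<open>4\<close> if the three
    signs agree and \<open>0\<close> otherwise, and likewise with \<open>d\<close> for \<open>c\<close>;
  \<^item> \<open>16 * t \<le> 3 + a * b + (a + b) * (c + d) + 2 * c * d - a - b - 2 * c - 2 * d\<close> from the polynomial
    \<open>2 + e\<^sub>2 - e\<^sub>1\<close> in the elementary symmetric functions of the four signs, whose value is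
    \<open>12\<close> on all-white cells, \<open>4\<close> on all-black cells and never negative.

  The same holds after exchanging the colours, that is, with \<open>a, b, c, d\<close> negated. It remains to see
  that these inequalities force \<open>t \<le> 0.1402\<close> (lemma \<open>density_bound\<close>). If \<open>t\<close> were larger, the
  first two families would force \<open>a, b, c, d\<close> to have the same sign, without loss of
  generality positive: the black lines are in the majority in each class. The first
  family keeps \<open>a\<close> and \<open>b\<close> small, the second then keeps \<open>c\<close> and \<open>d\<close> large, and the third
  inequality, which favours white cells, fails in this range. The margin is small: the three families
  meet at about \<open>t = 0.1401\<close>, where \<open>a\<close> and \<open>b\<close> are about \<open>0.251\<close> and \<open>c\<close> and \<open>d\<close> about \<open>0.115\<close>.
\<close>

section \<open>The optimisation problem for the average signs\<close>

text \<open>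
  If \<open>t > 0.1402\<close>, then \<open>4 * t > 701/1250\<close> and \<open>8 * t - 1 > 76/625\<close>; these are the constants of the
  following lemmas. Here the two hypotheses say \<open>\<bar>x + y\<bar> < 549/1250 + x * y\<close>, so that two averages of
  equal sign cannot both be large: \<open>4 * x * y \<le> (x + y)\<^sup>2\<close> yields a quadratic inequality for the product.
\<close>

lemma product_small:
  fixes x y :: real
  assumes "\<bar>x\<bar> \<le> 1" "\<bar>y\<bar> \<le> 1"
    and m: "(1 - x) * (1 - y) > 701 / 1250" and p: "(1 + x) * (1 + y) > 701 / 1250"
  shows "x * y < 76 / 625"
proof (rule ccontr)
  assume big: "\<not> x * y < 76 / 625"
  define p where "p = x * y"
  have "\<bar>x * y\<bar> \<le> 1"
    using assms by (simp add: abs_mult mult_le_one)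
  hence le1: "x * y \<le> 1" by linarith
  have "\<bar>x + y\<bar> \<le> 549 / 1250 + x * y"
    using m p by (simp add: algebra_simps abs_le_iff)
  hence "(x + y)\<^sup>2 \<le> (549 / 1250 + x * y)\<^sup>2"
    by (metis abs_ge_zero power2_abs power_mono)
  moreover have "4 * (x * y) \<le> (x + y)\<^sup>2"
    using zero_le_power2[of "x - y"] by (simp add: power2_eq_square algebra_simps)
  ultimately have "4 * p \<le> (549 / 1250 + p)\<^sup>2" by (simp add: p_def)
  moreover have "(p - 76 / 625) * (1 - p) \<ge> 0"
    using big le1 by (intro mult_nonneg_nonneg) (auto simp: p_def)
  moreover have "(549 / 1250 + p)\<^sup>2 = p * p + 549 / 625 * p + 301401 / 1562500"
    by (simp add: power2_eq_square algebra_simps)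
  moreover have "(p - 76 / 625) * (1 - p) = 701 / 625 * p - p * p - 76 / 625"
    by (simp add: field_simps)
  moreover have "p \<ge> 76 / 625" using big by (simp add: p_def)
  ultimately show False by linarith
qed

text \<open>
  No single product accounts for the whole sum, so \<open>x * (y + z)\<close>, \<open>y * (x + z)\<close> and
  \<open>z * (x + y)\<close> are positive: each of the three numbers has the sign of the sum of the other two.
\<close>

lemma same_sign:
  fixes x y z :: real
  assumes "x * y + x * z + y * z > 76 / 625"
    and "x * y < 76 / 625" "x * z < 76 / 625" "y * z < 76 / 625"
  shows "x > 0 \<and> y > 0 \<and> z > 0 \<or> x < 0 \<and> y < 0 \<and> z < 0"
proof -
  have "x * (y + z) > 0" "y * (x + z) > 0" "z * (x + y) > 0"
    using assms by (simp_all add: algebra_simps)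
  thus ?thesis
    unfolding zero_less_mult_iff by linarith
qed

text \<open>
  The left-hand side decreases in \<open>c\<close> and \<open>d\<close>, so the larger of these may be lowered to the smaller
  one, here \<open>c\<close>; and it increases with \<open>a * b\<close> for a given sum \<open>a + b\<close>, so both \<open>a\<close> and \<open>b\<close> may be
  replaced by their mean \<open>s\<close>. Now \<open>s\<close> is at most about \<open>0.2512\<close>, and \<open>c\<close> is bounded below
  in terms of \<open>s\<close> by a hyperbola, which is replaced by a line close to its tangent at this value. On
  that line the left-hand side is an increasing function of \<open>s\<close>, so the largest value of \<open>s\<close> decides.
\<close>

lemma no_positive_solution:
  fixes a b c d :: real
  assumes range: "0 < a" "a \<le> 1" "0 < b" "b \<le> 1" "0 < c" "0 < d"
    and ab: "(1 - a) * (1 - b) > 701 / 1250"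
    and ac: "(1 - a) * (1 - c) > 701 / 1250"
    and ad: "(1 - a) * (1 - d) > 701 / 1250"
    and abc: "a * b + a * c + b * c > 76 / 625"
    and abd: "a * b + a * d + b * d > 76 / 625"
  shows "3 + a * b + (a + b) * (c + d) + 2 * c * d - a - b - 2 * c - 2 * d < 1402 / 625"
  using range ac ad abc abd
proof (induction c d rule: linorder_wlog)
  case (sym c d)
  then show ?case by (simp add: algebra_simps)
next
  case (le c d)
  define s where "s = (a + b) / 2"
  have s0: "s > 0" using range by (simp add: s_def)
  have amgm: "a * b \<le> s\<^sup>2"
    using zero_le_power2[of "a - b"] by (simp add: s_def power2_eq_square field_simps)
  have s1: "s < 157 / 625"
  proof (rule ccontr)
    assume "\<not> s < 157 / 625"
    moreover have "s \<le> 1" using range by (simp add: s_def)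
    ultimately have "(1 - s)\<^sup>2 \<le> (468 / 625)\<^sup>2"
      by (intro power_mono) auto
    moreover have "(1 - a) * (1 - b) \<le> (1 - s)\<^sup>2"
      using amgm by (simp add: power2_eq_square algebra_simps s_def)
    ultimately show False using ab by (simp add: power2_eq_square)
  qed
  have c1: "c < 549 / 1250"
  proof -
    have "(1 - a) * (1 - c) > 0" using le by linarith
    hence "c < 1"
      using range by (auto simp: zero_less_mult_iff)
    hence "(1 - a) * (1 - c) \<le> 1 * (1 - c)"
      using range by (intro mult_right_mono) auto
    with le have "701 / 1250 < 1 - c" by simp
    thus ?thesis by simp
  qed
  \<comment> \<open>a rounded tangent at \<open>s = 0.2512\<close> to the curve \<open>s\<^sup>2 + 2 * s * l = 76/625\<close>, lying just below it\<close>
  define l where "l = 121 / 250 - 183 / 125 * s"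
  have cl: "c \<ge> l"
  proof (rule ccontr)
    assume "\<not> l \<le> c"
    hence "2 * s * c \<le> 2 * s * l"
      using s0 by (intro mult_left_mono) auto
    moreover have "76 / 625 < s\<^sup>2 + 2 * s * c"
    proof -
      have "2 * s * c = a * c + b * c" by (simp add: s_def field_simps)
      thus ?thesis using le amgm by simp
    qed
    moreover have "s\<^sup>2 + 2 * s * l \<le> 76 / 625"
      using zero_le_power2[of "s - 251 / 1000"] s1 by (simp add: l_def power2_eq_square algebra_simps)
    ultimately show False by linarith
  qed
  \<comment> \<open>lowering \<open>d\<close> to \<open>c\<close>\<close>
  have "(d - c) * (2 * c + 2 * s - 2) \<le> 0"
    using le c1 s1 by (intro mult_nonneg_nonpos) auto
  moreover have "b = 2 * s - a" by (simp add: s_def field_simps)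
  ultimately have "3 + a * b + (a + b) * (c + d) + 2 * c * d - a - b - 2 * c - 2 * d
     \<le> 3 + s\<^sup>2 + 4 * s * c + 2 * c\<^sup>2 - 2 * s - 4 * c"
    using amgm by (simp add: power2_eq_square algebra_simps)
  \<comment> \<open>lowering \<open>c\<close> to \<open>l\<close>\<close>
  also have "\<dots> \<le> 3 + s\<^sup>2 + 4 * s * l + 2 * l\<^sup>2 - 2 * s - 4 * l"
  proof -
    have "(c - l) * (2 * (c + l) + 4 * s - 4) \<le> 0"
      using cl c1 s1 by (intro mult_nonneg_nonpos) auto
    thus ?thesis by (simp add: power2_eq_square algebra_simps)
  qed
  also have "\<dots> < 1402 / 625"
    \<comment> \<open>the square bounds \<open>- s\<^sup>2\<close> above by its tangent at the endpoint \<open>157/625 = 0.2512\<close>\<close>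
    using s1 zero_le_power2[of "s - 157 / 625"] by (simp add: l_def power2_eq_square algebra_simps)
  finally show ?case .
qed

lemma density_bound:
  fixes a b c d t :: real
  assumes range: "\<bar>a\<bar> \<le> 1" "\<bar>b\<bar> \<le> 1" "\<bar>c\<bar> \<le> 1" "\<bar>d\<bar> \<le> 1"
    and white: "4 * t \<le> (1 - a) * (1 - b)" "4 * t \<le> (1 - a) * (1 - c)" "4 * t \<le> (1 - a) * (1 - d)"
      "4 * t \<le> (1 - b) * (1 - c)" "4 * t \<le> (1 - b) * (1 - d)"
      "16 * t \<le> 3 + a * b + (a + b) * (c + d) + 2 * c * d - a - b - 2 * c - 2 * d"
    and black: "4 * t \<le> (1 + a) * (1 + b)" "4 * t \<le> (1 + a) * (1 + c)" "4 * t \<le> (1 + a) * (1 + d)"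
      "4 * t \<le> (1 + b) * (1 + c)" "4 * t \<le> (1 + b) * (1 + d)"
      "16 * t \<le> 3 + a * b + (a + b) * (c + d) + 2 * c * d + a + b + 2 * c + 2 * d"
    and both: "8 * t \<le> 1 + a * b + a * c + b * c" "8 * t \<le> 1 + a * b + a * d + b * d"
  shows "t \<le> 701 / 5000"
proof (rule ccontr)
  assume "\<not> t \<le> 701 / 5000"
  hence t: "t > 701 / 5000" by simp
  have "a * b < 76 / 625" "a * c < 76 / 625" "a * d < 76 / 625" "b * c < 76 / 625" "b * d < 76 / 625"
    using t range white black by (intro product_small; linarith)+
  moreover have abc: "a * b + a * c + b * c > 76 / 625" and abd: "a * b + a * d + b * d > 76 / 625"
    using t both by auto
  ultimately consider "a > 0" "b > 0" "c > 0" "d > 0" | "a < 0" "b < 0" "c < 0" "d < 0"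
    using same_sign[of a b c] same_sign[of a b d] by force
  thus False
  proof cases
    case 1
    have "3 + a * b + (a + b) * (c + d) + 2 * c * d - a - b - 2 * c - 2 * d < 1402 / 625"
      using 1 t range white abc abd by (intro no_positive_solution) auto
    thus False using t white(6) by linarith
  next
    case 2
    have "3 + (-a) * (-b) + (-a + -b) * (-c + -d) + 2 * (-c) * (-d)
       - (-a) - (-b) - 2 * (-c) - 2 * (-d) < 1402 / 625"
      using 2 t range black abc abd by (intro no_positive_solution) auto
    thus False using t black(6) by (simp add: algebra_simps)
  qed
qed


section \<open>Sums over the cells of the torus\<close>

lemma bij_betw_progression:
  fixes c s :: int
  assumes n: "n > 0" and s: "coprime s (int n)"
  shows "bij_betw (\<lambda>j. (c + s * int j) mod int n) {1..n} {0..<int n}"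
proof -
  have inj: "inj_on (\<lambda>j. (c + s * int j) mod int n) {1..n}"
  proof (rule inj_onI)
    fix i j assume ij: "i \<in> {1..n}" "j \<in> {1..n}"
      and eq: "(c + s * int i) mod int n = (c + s * int j) mod int n"
    have "[c + s * int i = c + s * int j] (mod int n)" using eq by (simp add: cong_def)
    hence "[int i = int j] (mod int n)"
      using s by (simp add: cong_add_lcancel cong_mult_lcancel)
    hence "int n dvd int i - int j" by (simp add: cong_iff_dvd_diff)
    moreover have "\<bar>int i - int j\<bar> < int n" using ij by auto
    ultimately have "int i - int j = 0"
      using dvd_imp_le_int[of "int i - int j" "int n"] by linarith
    thus "i = j" by simp
  qed
  have "(\<lambda>j. (c + s * int j) mod int n) ` {1..n} = {0..<int n}"
  proof (rule card_subset_eq)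
    show "card ((\<lambda>j. (c + s * int j) mod int n) ` {1..n}) = card {0..<int n}"
      using card_image[OF inj] by simp
  qed (use n in auto)
  with inj show ?thesis by (simp add: bij_betw_def)
qed

lemma sum_progression:
  fixes g :: "int \<Rightarrow> real"
  assumes "n > 0" "coprime s (int n)"
  shows "(\<Sum>j\<in>{1..n}. g ((c + s * int j) mod int n)) = (\<Sum>k\<in>{0..<int n}. g k)"
  using sum.reindex_bij_betw[OF bij_betw_progression[OF assms]] .

text \<open>
  Along a fixed diagonal the skew diagonals advance in steps of two. As \<open>n\<close> is even, they stay in one
  parity class, and every member of it is visited twice.
\<close>

lemma sum_double_progression:
  fixes g :: "int \<Rightarrow> real"
  assumes "n > 0" "even n"
  shows "(\<Sum>j\<in>{1..n}. g ((c + 2 * int j) mod int n))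
    = 2 * (\<Sum>k\<in>{k\<in>{0..<int n}. even (k - c)}. g k)"
proof -
  obtain m where nm: "n = 2 * m" using assms by auto
  \<comment> \<open>Writing \<open>c = e + 2 * u\<close> and \<open>n = 2 * m\<close>, the progression is \<open>e\<close> plus twice a step-one progression modulo \<open>m\<close>.\<close>
  define e where "e = c mod 2"
  have e: "0 \<le> e" "e < 2" "even (c - e)"
    by (simp_all add: e_def)
  then obtain u where u: "c = e + 2 * u" by (metis add.commute diff_add_cancel evenE)
  have m: "m > 0" using assms nm by simp
  have halve: "(c + 2 * int j) mod int n = e + 2 * ((u + int j) mod int m)" for j
  proof -
    have "(c + 2 * int j) mod int n = (e + 2 * (u + int j)) mod (2 * int m)"
      by (simp add: u nm algebra_simps)
    also have "\<dots> = (e + 2 * ((u + int j) mod int m)) mod (2 * int m)"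
      by (simp add: mod_simps mult_mod_right)
    also have "\<dots> = e + 2 * ((u + int j) mod int m)"
    proof (rule mod_pos_pos_trivial)
      have "(u + int j) mod int m < int m" "0 \<le> (u + int j) mod int m" using m by simp_all
      thus "0 \<le> e + 2 * ((u + int j) mod int m)" "e + 2 * ((u + int j) mod int m) < 2 * int m"
        using e by linarith+
    qed
    finally show ?thesis .
  qed
  have half: "(\<Sum>k\<in>{0..<int m}. g (e + 2 * k)) = (\<Sum>k\<in>{k\<in>{0..<int n}. even (k - c)}. g k)"
  proof (rule sum.reindex_bij_witness[of _ "\<lambda>k. (k - e) div 2" "\<lambda>k. e + 2 * k"])
    fix k assume "k \<in> {k\<in>{0..<int n}. even (k - c)}"
    hence k: "0 \<le> k" "k < 2 * int m" "even (k - e)" using u by (auto simp: nm)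
    then obtain v where v: "k = e + 2 * v" by (metis add.commute diff_add_cancel evenE)
    show "e + 2 * ((k - e) div 2) = k" by (simp add: v)
    show "(k - e) div 2 \<in> {0..<int m}" using k e by (auto simp: v)
  next
    fix k assume "k \<in> {0..<int m}"
    thus "e + 2 * k \<in> {k\<in>{0..<int n}. even (k - c)}"
      using e by (simp add: nm u)
  qed simp_all
  define f where "f j = g (e + 2 * ((u + int j) mod int m))" for j
  have "(\<Sum>j\<in>{1..n}. g ((c + 2 * int j) mod int n)) = (\<Sum>j\<in>{1..m + m}. f j)"
  proof -
    have "m + m = n" by (simp add: nm)
    thus ?thesis by (simp only: halve f_def)
  qed
  also have "\<dots> = (\<Sum>j\<in>{1..m}. f j) + (\<Sum>j\<in>{m + 1..m + m}. f j)"
    by (rule sum.ub_add_nat) simp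
  also have "(\<Sum>j\<in>{m + 1..m + m}. f j) = (\<Sum>j\<in>{1..m}. f (j + m))"
    using sum.shift_bounds_cl_nat_ivl[of f 1 m m] by (simp add: add.commute)
  also have "\<dots> = (\<Sum>j\<in>{1..m}. f j)"
    by (simp add: f_def flip: add.assoc)
  also have "(\<Sum>j\<in>{1..m}. f j) = (\<Sum>k\<in>{0..<int m}. g (e + 2 * k))"
    unfolding f_def using sum_progression[of m 1 "\<lambda>k. g (e + 2 * k)" u] m by simp
  finally show ?thesis using half by simp
qed

text \<open>
  The cell \<open>(i, j)\<close> on the diagonal \<open>k\<close> lies on the skew diagonal \<open>k + 2 * j\<close>, so the sum can be
  taken over \<open>k\<close> and \<open>j\<close> instead of \<open>i\<close> and \<open>j\<close>.
\<close>

lemma sum_diagonal_skew: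
  fixes g h :: "int \<Rightarrow> real"
  assumes "n > 0" "even n"
  shows "(\<Sum>i\<in>{1..n}. \<Sum>j\<in>{1..n}. g ((int i - int j) mod int n) * h ((int i + int j) mod int n))
    = 2 * ((\<Sum>k\<in>{k\<in>{0..<int n}. even k}. g k) * (\<Sum>k\<in>{k\<in>{0..<int n}. even k}. h k)
         + (\<Sum>k\<in>{k\<in>{0..<int n}. odd k}. g k) * (\<Sum>k\<in>{k\<in>{0..<int n}. odd k}. h k))"
proof -
  let ?K = "{0..<int n}"
  let ?H = "\<lambda>k. \<Sum>l\<in>{l\<in>?K. even (l - k)}. h l"
  have "(\<Sum>i\<in>{1..n}. \<Sum>j\<in>{1..n}. g ((int i - int j) mod int n) * h ((int i + int j) mod int n))
      = (\<Sum>j\<in>{1..n}. \<Sum>i\<in>{1..n}. g ((- int j + 1 * int i) mod int n)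
           * h (((- int j + 1 * int i) mod int n + 2 * int j) mod int n))"
    by (subst sum.swap) (simp add: mod_simps algebra_simps)
  also have "\<dots> = (\<Sum>j\<in>{1..n}. \<Sum>k\<in>?K. g k * h ((k + 2 * int j) mod int n))"
    using sum_progression[of n 1 "\<lambda>k. g k * h ((k + 2 * int j) mod int n)" "- int j" for j] assms
    by simp
  also have "\<dots> = (\<Sum>k\<in>?K. g k * (2 * ?H k))"
    by (subst sum.swap) (simp only: sum_distrib_left[symmetric] sum_double_progression[OF assms])
  also have "\<dots> = (\<Sum>k\<in>{k\<in>?K. even k}. g k * (2 * ?H k)) + (\<Sum>k\<in>{k\<in>?K. odd k}. g k * (2 * ?H k))"
    by (subst sum.union_disjoint[symmetric]) (auto intro!: sum.cong finite_subset[of _ ?K])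
  also have "(\<Sum>k\<in>{k\<in>?K. even k}. g k * (2 * ?H k))
      = (\<Sum>k\<in>{k\<in>?K. even k}. g k * (2 * (\<Sum>l\<in>{l\<in>?K. even l}. h l)))"
    by (intro sum.cong refl) auto
  also have "(\<Sum>k\<in>{k\<in>?K. odd k}. g k * (2 * ?H k))
      = (\<Sum>k\<in>{k\<in>?K. odd k}. g k * (2 * (\<Sum>l\<in>{l\<in>?K. odd l}. h l)))"
    by (intro sum.cong refl) auto
  finally show ?thesis
    by (simp add: sum_distrib_right[symmetric] algebra_simps)
qed


section \<open>Coloured tori\<close>

text \<open>
  Only the signs of the lines matter for the averaging, not how they come from the battle. In this form
  the hypotheses are symmetric under exchanging \<open>B\<close> and \<open>W\<close> and negating all signs, whereas a line
  that meets neither set breaks the symmetry of the definition by which it gets its colour.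
\<close>

locale coloured_torus =
  fixes n :: nat and x y :: "nat \<Rightarrow> real" and z w :: "int \<Rightarrow> real"
    and B W :: "(nat \<times> nat) set"
  assumes n_pos: "n > 0" and n_even: "even n"
    and signs: "\<bar>x i\<bar> = 1" "\<bar>y i\<bar> = 1" "\<bar>z k\<bar> = 1" "\<bar>w k\<bar> = 1"
    and cells: "B \<subseteq> torus_vertices n" "W \<subseteq> torus_vertices n"
    and black: "(i, j) \<in> B \<Longrightarrow>
      x i = 1 \<and> y j = 1 \<and> z ((int i - int j) mod int n) = 1 \<and> w ((int i + int j) mod int n) = 1"
    and white: "(i, j) \<in> W \<Longrightarrow>
      x i = -1 \<and> y j = -1 \<and> z ((int i - int j) mod int n) = -1 \<and> w ((int i + int j) mod int n) = -1"
begin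

lemma swap_colours:
  "coloured_torus n (\<lambda>i. - x i) (\<lambda>j. - y j) (\<lambda>k. - z k) (\<lambda>k. - w k) W B"
  using n_pos n_even signs cells black white by unfold_locales auto

abbreviation diag :: "nat \<Rightarrow> nat \<Rightarrow> real" where
  "diag i j \<equiv> z ((int i - int j) mod int n)"

abbreviation skew :: "nat \<Rightarrow> nat \<Rightarrow> real" where
  "skew i j \<equiv> w ((int i + int j) mod int n)"

definition a :: real where "a = (\<Sum>i\<in>{1..n}. x i) / n"
definition b :: real where "b = (\<Sum>j\<in>{1..n}. y j) / n"
definition c :: real where "c = (\<Sum>k\<in>{0..<int n}. z k) / n"
definition d :: real where "d = (\<Sum>k\<in>{0..<int n}. w k) / n"

definition mean :: "(nat \<Rightarrow> nat \<Rightarrow> real) \<Rightarrow> real" where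
  "mean f = (\<Sum>i\<in>{1..n}. \<Sum>j\<in>{1..n}. f i j) / (real n)\<^sup>2"

lemma mean_add: "mean (\<lambda>i j. f i j + g i j) = mean f + mean g"
  by (simp add: mean_def sum.distrib add_divide_distrib)

lemma mean_diff: "mean (\<lambda>i j. f i j - g i j) = mean f - mean g"
  by (simp add: mean_def sum_subtractf diff_divide_distrib)

lemma mean_cmult: "mean (\<lambda>i j. r * f i j) = r * mean f"
  by (simp add: mean_def sum_distrib_left)

lemma mean_mono: "(\<And>i j. f i j \<le> g i j) \<Longrightarrow> mean f \<le> mean g"
  by (auto simp: mean_def intro!: divide_right_mono sum_mono)

lemma mean_const: "mean (\<lambda>i j. r) = r"
  using n_pos by (simp add: mean_def power2_eq_square)

lemma sum_diag_row: "(\<Sum>j\<in>{1..n}. diag i j) = n * c"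
  using sum_progression[of n "-1" z "int i"] n_pos by (simp add: c_def)

lemma sum_diag_column: "(\<Sum>i\<in>{1..n}. diag i j) = n * c"
  using sum_progression[of n 1 z "- int j"] n_pos by (simp add: c_def)

lemma sum_skew_row: "(\<Sum>j\<in>{1..n}. skew i j) = n * d"
  using sum_progression[of n 1 w "int i"] n_pos by (simp add: d_def)

lemma sum_skew_column: "(\<Sum>i\<in>{1..n}. skew i j) = n * d"
  using sum_progression[of n 1 w "int j"] n_pos by (simp add: d_def add.commute)

lemma sum_row: "(\<Sum>i\<in>{1..n}. x i) = n * a" and sum_column: "(\<Sum>j\<in>{1..n}. y j) = n * b"
  using n_pos by (simp_all add: a_def b_def)

text \<open>
  This gives the averages of all products of two signs except diagonal times skew diagonal: the sum of
  the signs of one class along a row (or column) is the same for every row (column), since each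
  line of that class is met once.
\<close>

lemma mean_row:
  fixes f :: "nat \<Rightarrow> nat \<Rightarrow> real" and r :: real
  assumes "\<And>i. (\<Sum>j\<in>{1..n}. f i j) = n * r"
  shows "mean (\<lambda>i j. x i * f i j) = a * r" "mean f = r"
proof -
  have "(\<Sum>i\<in>{1..n}. \<Sum>j\<in>{1..n}. x i * f i j) = (n * a) * (n * r)"
    by (simp only: sum_distrib_left[symmetric] assms sum_distrib_right[symmetric] sum_row)
  moreover have "(\<Sum>i\<in>{1..n}. \<Sum>j\<in>{1..n}. f i j) = n * (n * r)"
    by (simp only: assms) simp
  ultimately show "mean (\<lambda>i j. x i * f i j) = a * r" "mean f = r"
    using n_pos by (simp_all only: mean_def) (simp_all add: power2_eq_square)
qed

lemma mean_column:
  fixes f :: "nat \<Rightarrow> nat \<Rightarrow> real" and r :: real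
  assumes "\<And>j. (\<Sum>i\<in>{1..n}. f i j) = n * r"
  shows "mean (\<lambda>i j. y j * f i j) = b * r" "mean f = r"
proof -
  have "(\<Sum>i\<in>{1..n}. \<Sum>j\<in>{1..n}. y j * f i j) = (n * b) * (n * r)"
    by (subst sum.swap)
      (simp only: sum_distrib_left[symmetric] assms sum_distrib_right[symmetric] sum_column)
  moreover have "(\<Sum>i\<in>{1..n}. \<Sum>j\<in>{1..n}. f i j) = n * (n * r)"
    by (subst sum.swap) (simp only: assms, simp)
  ultimately show "mean (\<lambda>i j. y j * f i j) = b * r" "mean f = r"
    using n_pos by (simp_all only: mean_def) (simp_all add: power2_eq_square)
qed

lemmas mean_pairwise =
  mean_row[where f = "\<lambda>i j. y j", OF sum_column]
  mean_column(2)[where f = "\<lambda>i j. x i", OF sum_row]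
  mean_row[OF sum_diag_row] mean_row[OF sum_skew_row]
  mean_column(1)[OF sum_diag_column] mean_column(1)[OF sum_skew_column]

lemma abs_sum_signs: "(\<And>k. k \<in> A \<Longrightarrow> \<bar>f k :: real\<bar> = 1) \<Longrightarrow> \<bar>\<Sum>k\<in>A. f k\<bar> \<le> card A"
  using sum_abs[of f A] by simp

lemma averages_range: "\<bar>a\<bar> \<le> 1" "\<bar>b\<bar> \<le> 1" "\<bar>c\<bar> \<le> 1" "\<bar>d\<bar> \<le> 1"
  using abs_sum_signs[of "{1..n}" x] abs_sum_signs[of "{1..n}" y]
    abs_sum_signs[of "{0..<int n}" z] abs_sum_signs[of "{0..<int n}" w] n_pos
  by (simp_all add: signs a_def b_def c_def d_def)

text \<open>
  Let \<open>c\<^sub>0, c\<^sub>1\<close> and \<open>d\<^sub>0, d\<^sub>1\<close> be the average signs of the diagonals and skew diagonals of even and odd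
  index. Only lines of equal parity meet, so the mean is \<open>(c\<^sub>0 * d\<^sub>0 + c\<^sub>1 * d\<^sub>1) / 2\<close>. What this
  falls short of the bound is \<open>((1 - c\<^sub>0) * (1 - d\<^sub>1) + (1 - c\<^sub>1) * (1 - d\<^sub>0)) / 2\<close>, which measures the
  pairs of white lines of opposite parity.
\<close>

lemma mean_diag_skew: "mean (\<lambda>i j. diag i j * skew i j) \<le> 1 - c - d + 2 * c * d"
proof -
  define E where "E = {k\<in>{0..<int n}. even k}"
  define F where "F = {k\<in>{0..<int n}. odd k}"
  define c0 c1 where "c0 = 2 * (\<Sum>k\<in>E. z k) / n" and "c1 = 2 * (\<Sum>k\<in>F. z k) / n"
  define d0 d1 where "d0 = 2 * (\<Sum>k\<in>E. w k) / n" and "d1 = 2 * (\<Sum>k\<in>F. w k) / n"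
  have EF: "E \<union> F = {0..<int n}" "E \<inter> F = {}" "finite E" "finite F"
    by (auto simp: E_def F_def intro: finite_subset[of _ "{0..<int n}"])
  have card: "2 * real (card E) = n" "2 * real (card F) = n"
    using sum_double_progression[OF n_pos n_even, of "\<lambda>_. 1" 0]
      sum_double_progression[OF n_pos n_even, of "\<lambda>_. 1" 1]
    by (simp_all add: E_def F_def)
  have halves: "c0 \<le> 1" "c1 \<le> 1" "d0 \<le> 1" "d1 \<le> 1"
    using abs_sum_signs[of E z] abs_sum_signs[of F z] abs_sum_signs[of E w] abs_sum_signs[of F w]
      card n_pos
    by (simp_all add: signs c0_def c1_def d0_def d1_def)
  have avg: "c = (c0 + c1) / 2" "d = (d0 + d1) / 2"
    unfolding c_def d_def c0_def c1_def d0_def d1_def EF(1)[symmetric]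
      sum.union_disjoint[OF EF(3,4,2)] by (simp_all add: add_divide_distrib)
  have "mean (\<lambda>i j. diag i j * skew i j) = (c0 * d0 + c1 * d1) / 2"
    using n_pos unfolding mean_def sum_diagonal_skew[OF n_pos n_even] E_def[symmetric] F_def[symmetric]
    by (simp add: c0_def c1_def d0_def d1_def power2_eq_square field_simps)
  moreover have "0 \<le> (1 - c0) * (1 - d1) + (1 - c1) * (1 - d0)"
    using halves by simp
  ultimately show ?thesis unfolding avg by (simp add: field_simps)
qed

lemma mean_of_bool:
  assumes "A \<subseteq> torus_vertices n"
  shows "mean (\<lambda>i j. of_bool ((i, j) \<in> A)) = card A / n\<^sup>2"
proof -
  have "(\<Sum>i\<in>{1..n}. \<Sum>j\<in>{1..n}. of_bool ((i, j) \<in> A) :: real)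
      = (\<Sum>v\<in>torus_vertices n. of_bool (v \<in> A))"
    unfolding torus_vertices_def by (simp only: sum.cartesian_product case_prod_unfold prod.collapse)
  also have "\<dots> = card A"
    using assms by (simp add: torus_vertices_def of_bool_def sum.If_cases Int_absorb1)
  finally show ?thesis by (simp add: mean_def)
qed

lemma weighted_battle:
  assumes "\<And>i j. 0 \<le> f i j"
    and "\<And>i j. (i, j) \<in> B \<Longrightarrow> p \<le> f i j" "\<And>i j. (i, j) \<in> W \<Longrightarrow> q \<le> f i j"
  shows "p * (card B / n\<^sup>2) + q * (card W / n\<^sup>2) \<le> mean f"
proof -
  have "mean (\<lambda>i j. p * of_bool ((i, j) \<in> B) + q * of_bool ((i, j) \<in> W)) \<le> mean f"
  proof (rule mean_mono)
    fix i j
    have "\<not> ((i, j) \<in> B \<and> (i, j) \<in> W)" using black[of i j] white[of i j] by force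
    thus "p * of_bool ((i, j) \<in> B) + q * of_bool ((i, j) \<in> W) \<le> f i j"
      using assms by auto
  qed
  thus ?thesis by (simp add: mean_add mean_cmult mean_of_bool cells)
qed

lemma sign_cases: "x i = 1 \<or> x i = -1" "y i = 1 \<or> y i = -1" "z k = 1 \<or> z k = -1" "w k = 1 \<or> w k = -1"
  using signs(1)[of i] signs(2)[of i] signs(3)[of k] signs(4)[of k] by linarith+

lemma mean_white_product:
  "mean (\<lambda>i j. (1 - x i) * (1 - y j)) = (1 - a) * (1 - b)"
  "mean (\<lambda>i j. (1 - x i) * (1 - diag i j)) = (1 - a) * (1 - c)"
  "mean (\<lambda>i j. (1 - x i) * (1 - skew i j)) = (1 - a) * (1 - d)"
  "mean (\<lambda>i j. (1 - y j) * (1 - diag i j)) = (1 - b) * (1 - c)"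
  "mean (\<lambda>i j. (1 - y j) * (1 - skew i j)) = (1 - b) * (1 - d)"
  unfolding left_diff_distrib right_diff_distrib mult_1 mult_1_right
    mean_add mean_diff mean_const mean_pairwise by simp_all

lemma white_product_bounds:
  defines "t \<equiv> card W / n\<^sup>2"
  shows "4 * t \<le> (1 - a) * (1 - b)" "4 * t \<le> (1 - a) * (1 - c)" "4 * t \<le> (1 - a) * (1 - d)"
    "4 * t \<le> (1 - b) * (1 - c)" "4 * t \<le> (1 - b) * (1 - d)"
proof -
  have sub: "0 \<le> 1 - x i" "0 \<le> 1 - y j" "0 \<le> 1 - z k" "0 \<le> 1 - w k" for i j k
    using signs(1)[of i] signs(2)[of j] signs(3)[of k] signs(4)[of k] by linarith+
  show "4 * t \<le> (1 - a) * (1 - b)" "4 * t \<le> (1 - a) * (1 - c)" "4 * t \<le> (1 - a) * (1 - d)"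
    "4 * t \<le> (1 - b) * (1 - c)" "4 * t \<le> (1 - b) * (1 - d)"
    unfolding mean_white_product[symmetric] t_def
    using weighted_battle[where p = 0 and q = 4] sub white by simp_all
qed

text \<open>
  The polynomial below is \<open>(s - 2) * s / 2\<close> in terms of the sum \<open>s \<in> {-4, -2, 0, 2, 4}\<close> of the
  four signs. Its zeros are consecutive possible values of \<open>s\<close>, so it is never negative, and they are
  placed so that all-white cells count three times as much as all-black ones. This uses all four classes
  of lines at once.
\<close>

lemma white_heavy_bound:
  "12 * (card W / n\<^sup>2) + 4 * (card B / n\<^sup>2)
     \<le> 3 + a * b + (a + b) * (c + d) + 2 * c * d - a - b - 2 * c - 2 * d"
proof -
  let ?f = "\<lambda>i j. 2 + (x i * y j + x i * diag i j + x i * skew i j + y j * diag i j + y j * skew i j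
      + diag i j * skew i j) - x i - y j - diag i j - skew i j"
  have "4 * (card B / n\<^sup>2) + 12 * (card W / n\<^sup>2) \<le> mean ?f"
  proof (rule weighted_battle)
    fix i j
    show "0 \<le> ?f i j"
      using sign_cases(1)[of i] sign_cases(2)[of j] sign_cases(3)[of "(int i - int j) mod int n"]
        sign_cases(4)[of "(int i + int j) mod int n"] by auto
  qed (use black white in auto)
  also have "\<dots> = 2 + (a * b + a * c + a * d + b * c + b * d
      + mean (\<lambda>i j. diag i j * skew i j)) - a - b - c - d"
    by (simp only: mean_add mean_diff mean_const mean_pairwise)
  finally show ?thesis using mean_diag_skew by (simp add: algebra_simps)
qed

lemma monochromatic_bounds:
  "4 * (card B / n\<^sup>2) + 4 * (card W / n\<^sup>2) \<le> 1 + a * b + a * c + b * c"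
  "4 * (card B / n\<^sup>2) + 4 * (card W / n\<^sup>2) \<le> 1 + a * b + a * d + b * d"
proof -
  let ?f = "\<lambda>i j. 1 + x i * y j + x i * diag i j + y j * diag i j"
  have "4 * (card B / n\<^sup>2) + 4 * (card W / n\<^sup>2) \<le> mean ?f"
  proof (rule weighted_battle)
    fix i j
    show "0 \<le> ?f i j"
      using sign_cases(1)[of i] sign_cases(2)[of j] sign_cases(3)[of "(int i - int j) mod int n"] by auto
  qed (use black white in auto)
  thus "4 * (card B / n\<^sup>2) + 4 * (card W / n\<^sup>2) \<le> 1 + a * b + a * c + b * c"
    by (simp only: mean_add mean_const mean_pairwise)
  let ?g = "\<lambda>i j. 1 + x i * y j + x i * skew i j + y j * skew i j"
  have "4 * (card B / n\<^sup>2) + 4 * (card W / n\<^sup>2) \<le> mean ?g"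
  proof (rule weighted_battle)
    fix i j
    show "0 \<le> ?g i j"
      using sign_cases(1)[of i] sign_cases(2)[of j] sign_cases(4)[of "(int i + int j) mod int n"] by auto
  qed (use black white in auto)
  thus "4 * (card B / n\<^sup>2) + 4 * (card W / n\<^sup>2) \<le> 1 + a * b + a * d + b * d"
    by (simp only: mean_add mean_const mean_pairwise)
qed

end

lemma (in coloured_torus) equal_armies_bound:
  assumes eq: "card B = card W"
  shows "card B / n\<^sup>2 \<le> 701 / 5000"
proof -
  interpret swap: coloured_torus n "\<lambda>i. - x i" "\<lambda>j. - y j" "\<lambda>k. - z k" "\<lambda>k. - w k" W B
    by (rule swap_colours)
  have "swap.a = - a" "swap.b = - b" "swap.c = - c" "swap.d = - d"
    by (simp_all add: swap.a_def swap.b_def swap.c_def swap.d_def a_def b_def c_def d_def sum_negf)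
  note swapped = this minus_minus diff_minus_eq_add mult_minus_left mult_minus_right
  define t where "t = card B / n\<^sup>2"
  note white = white_product_bounds[folded eq, folded t_def] white_heavy_bound[folded eq, folded t_def]
  note black = swap.white_product_bounds[folded t_def, unfolded swapped]
    swap.white_heavy_bound[folded eq, folded t_def, unfolded swapped]
  note both = monochromatic_bounds[folded eq, folded t_def]
  have "t \<le> 701 / 5000"
    using averages_range white black both by (intro density_bound[of a b c d t]) (simp_all add: algebra_simps)
  thus ?thesis by (simp add: t_def)
qed

section \<open>Colouring the lines of a battle\<close>

definition line_sign :: "(nat \<times> nat) set \<Rightarrow> (nat \<times> nat) set \<Rightarrow> real" where
  "line_sign B e = (if e \<inter> B = {} then -1 else 1)"

lemma battle_coloured_torus:
  assumes "n > 0" "even n" and battle: "peaceful_battle n B W"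
  shows "coloured_torus n (\<lambda>i. line_sign B (torus_row n i)) (\<lambda>j. line_sign B (torus_column n j))
    (\<lambda>k. line_sign B (torus_diagonal n k)) (\<lambda>k. line_sign B (torus_skew_diagonal n k)) B W"
proof -
  have cells: "B \<subseteq> torus_vertices n" "W \<subseteq> torus_vertices n"
    using battle by (auto simp: peaceful_battle_def)
  have on_lines: "(i, j) \<in> torus_row n i \<inter> torus_column n j
      \<inter> torus_diagonal n ((int i - int j) mod int n) \<inter> torus_skew_diagonal n ((int i + int j) mod int n)"
    "torus_row n i \<in> torus_edges n" "torus_column n j \<in> torus_edges n"
    "torus_diagonal n ((int i - int j) mod int n) \<in> torus_edges n"
    "torus_skew_diagonal n ((int i + int j) mod int n) \<in> torus_edges n"
    if "(i, j) \<in> torus_vertices n" for i j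
    using that \<open>n > 0\<close>
    by (auto simp: torus_vertices_def torus_row_def torus_column_def torus_diagonal_def
        torus_skew_diagonal_def torus_edges_def cong_def)
  have black: "line_sign B e = 1" if "v \<in> B" "v \<in> e" for e v
    using that by (auto simp: line_sign_def)
  have white: "line_sign B e = -1" if "v \<in> W" "v \<in> e" "e \<in> torus_edges n" for e v
    using that battle by (auto simp: line_sign_def peaceful_battle_def)
  show ?thesis
  proof (unfold_locales, goal_cases)
    case (9 i j)
    then show ?case using on_lines(1)[of i j] cells by (auto intro!: black[of "(i, j)"])
  next
    case (10 i j)
    then show ?case using on_lines[of i j] cells by (auto intro!: white[of "(i, j)"])
  qed (use assms cells in \<open>auto simp: line_sign_def\<close>)
qed

theorem theorem1p2:
  fixes n :: nat
  assumes "n > 0" and "even n"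
  shows "real (peaceful_number n) \<le> 0.1402 * (real n)\<^sup>2"
proof -
  have "peaceful_number n \<in> battle_sizes n"
    unfolding peaceful_number_def using finite_battle_sizes zero_in_battle_sizes by (intro Max_in) auto
  then obtain B W where battle: "peaceful_battle n B W"
    and B: "card B = peaceful_number n" and W: "card W = peaceful_number n"
    by (auto simp: battle_sizes_def)
  have "card B / (real n)\<^sup>2 \<le> 701 / 5000"
    using coloured_torus.equal_armies_bound[OF battle_coloured_torus[OF assms battle]] B W by simp
  thus ?thesis using assms(1) by (simp add: B field_simps)
qed

end
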